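(* Let $n\ge2$ and let $\mathbf A=(A,q,\mathsf e_1,\dots,\mathsf e_n)$ be an $n\mathrm{BA}$. (i) Every multideal of $\mathbf A$ can be extended to an ultramultideal: for every multideal $(I_1,\dots,I_n)$ of $\mathbf A$ there is an ultramultideal $(G_1,\dots,G_n)$ of $\mathbf A$ with $I_k\subseteq G_k$ for all $k$. (ii) There is a bijective correspondence between the ultramultideals of $\mathbf A$ and the homomorphisms from $\mathbf A$ onto $\mathbf n$.
   Context: Let $n\ge 2$. An $n\mathrm{BA}$ (Boolean-like algebra of dimension $n$) is an algebra $\mathbf A=(A,q,\mathsf e_1,\dots,\mathsf e_n)$ with $q$ of arity $n+1$ and constants $\mathsf e_1,\dots,\mathsf e_n$ satisfying the identities (B0) $q(\mathsf e_i,x^1,\dots,x^n)=x^i$ for $i=1,\dots,n$; (B1) $q(y,x,\dots,x)=x$; (B2) $q(y,q(y,x^{11},\dots,x^{1n}),\dots,q(y,x^{n1},\dots,x^{nn}))=q(y,x^{11},x^{22},\dots,x^{nn})$; (B3) $q(y,q(x^{10},\dots,x^{1n}),\dots,q(x^{n0},\dots,x^{nn}))=q(q(y,x^{10},\dots,x^{n0}),\dots,q(y,x^{1n},\dots,x^{nn}))$; (B4) $q(y,\mathsf e_1,\dots,\mathsf e_n)=y$. $\mathbf n$ is the $n\mathrm{BA}$ with the $n$-element universe $\{\mathsf e_1,\dots,\mathsf e_n\}$ and $q(\mathsf e_i,x^1,\dots,x^n)=x^i$. A multideal of $\mathbf A$ is a tuple $(I_1,\dots,I_n)$ of pairwise disjoint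 subsets of $A$ such that: (m1) $\mathsf e_k\in I_k$ for all $k$; (m2) if $a\in I_r$, $b\in I_k$ and $y_1,\dots,y_n\in A$, then $q(a,y_1,\dots,y_{r-1},b,y_{r+1},\dots,y_n)\in I_k$; (m3) if $a\in A$ and $y_1,\dots,y_n\in I_k$, then $q(a,y_1,\dots,y_n)\in I_k$. An ultramultideal is a multideal with $I_1\cup\dots\cup I_n=A$. *)

theory Defs
  imports Main "HOL-Library.FuncSet" "HOL-Library.Cardinality"
begin

text \<open>
  The dimension \<open>n\<close> is the cardinality of a finite index type \<open>'n\<close>. The \<open>(n+1)\<close>-ary operation
  \<open>q\<close> takes its first argument separately and the remaining \<open>n\<close> arguments as a family
  \<open>x :: 'n \<Rightarrow> 'a\<close>; \<open>e\<close> is the family of constants. The order of the indices plays no role in the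
  axioms, so none is imposed on \<open>'n\<close>.

  In \<open>B3\<close> the entries \<open>x\<^sup>i\<^sup>0\<close> are the family \<open>z\<close>, and the entries
  \<open>x\<^sup>i\<^sup>j\<close> with \<open>j \<ge> 1\<close> are \<open>w i j\<close>; likewise \<open>w\<close> in \<open>B2\<close>.
\<close>

locale nBA =
  fixes A :: "'a set"
    and q :: "'a \<Rightarrow> ('n::finite \<Rightarrow> 'a) \<Rightarrow> 'a"
    and e :: "'n \<Rightarrow> 'a"
  assumes q_closed: "\<lbrakk>y \<in> A; \<And>i. x i \<in> A\<rbrakk> \<Longrightarrow> q y x \<in> A"
    and e_closed: "e i \<in> A"
    and B0: "(\<And>i. x i \<in> A) \<Longrightarrow> q (e i) x = x i"
    and B1: "\<lbrakk>y \<in> A; a \<in> A\<rbrakk> \<Longrightarrow> q y (\<lambda>_. a) = a"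
    and B2: "\<lbrakk>y \<in> A; \<And>i j. w i j \<in> A\<rbrakk> \<Longrightarrow> q y (\<lambda>i. q y (w i)) = q y (\<lambda>i. w i i)"
    and B3: "\<lbrakk>y \<in> A; \<And>i. z i \<in> A; \<And>i j. w i j \<in> A\<rbrakk> \<Longrightarrow>
               q y (\<lambda>i. q (z i) (w i)) = q (q y z) (\<lambda>j. q y (\<lambda>i. w i j))"
    and B4: "y \<in> A \<Longrightarrow> q y e = y"

text \<open>
  The algebra \<open>\<^bold>n\<close>: its universe is the index type itself, with the \<open>i\<close>-th constant being \<open>i\<close>.
\<close>

definition std_q :: "'n \<Rightarrow> ('n \<Rightarrow> 'n) \<Rightarrow> 'n" where
  "std_q i x = x i"

definition std_e :: "'n \<Rightarrow> 'n" where
  "std_e i = i"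

lemma nBA_std: "nBA (UNIV :: 'n::finite set) std_q std_e"
  by unfold_locales (simp_all add: std_q_def std_e_def)

definition multideal ::
  "'a set \<Rightarrow> ('a \<Rightarrow> ('n::finite \<Rightarrow> 'a) \<Rightarrow> 'a) \<Rightarrow> ('n \<Rightarrow> 'a) \<Rightarrow> ('n \<Rightarrow> 'a set) \<Rightarrow> bool" where
  "multideal A q e I \<longleftrightarrow>
     (\<forall>k. I k \<subseteq> A) \<and>
     (\<forall>j k. j \<noteq> k \<longrightarrow> I j \<inter> I k = {}) \<and>
     (\<forall>k. e k \<in> I k) \<and>
     (\<forall>r k. \<forall>a \<in> I r. \<forall>b \<in> I k. \<forall>y. (\<forall>i. y i \<in> A) \<longrightarrow> q a (y(r := b)) \<in> I k) \<and>
     (\<forall>k. \<forall>a \<in> A. \<forall>y. (\<forall>i. y i \<in> I k) \<longrightarrow> q a y \<in> I k)"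

definition ultramultideal ::
  "'a set \<Rightarrow> ('a \<Rightarrow> ('n::finite \<Rightarrow> 'a) \<Rightarrow> 'a) \<Rightarrow> ('n \<Rightarrow> 'a) \<Rightarrow> ('n \<Rightarrow> 'a set) \<Rightarrow> bool" where
  "ultramultideal A q e G \<longleftrightarrow> multideal A q e G \<and> (\<Union>k. G k) = A"

text \<open>
  Homomorphisms are taken to be extensional (\<open>undefined\<close> outside \<open>A\<close>), so that HOL functions
  satisfying the predicate correspond one-to-one to maps with domain \<open>A\<close>.
\<close>

definition nBA_hom ::
  "'a set \<Rightarrow> ('a \<Rightarrow> ('n::finite \<Rightarrow> 'a) \<Rightarrow> 'a) \<Rightarrow> ('n \<Rightarrow> 'a) \<Rightarrow>
   'b set \<Rightarrow> ('b \<Rightarrow> ('n \<Rightarrow> 'b) \<Rightarrow> 'b) \<Rightarrow> ('n \<Rightarrow> 'b) \<Rightarrow> ('a \<Rightarrow> 'b) \<Rightarrow> bool" where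
  "nBA_hom A q e B q' e' f \<longleftrightarrow>
     f \<in> A \<rightarrow>\<^sub>E B \<and>
     (\<forall>i. f (e i) = e' i) \<and>
     (\<forall>y \<in> A. \<forall>x. (\<forall>i. x i \<in> A) \<longrightarrow> f (q y x) = q' (f y) (\<lambda>i. f (x i)))"

definition onto_homs_std ::
  "'a set \<Rightarrow> ('a \<Rightarrow> ('n::finite \<Rightarrow> 'a) \<Rightarrow> 'a) \<Rightarrow> ('n \<Rightarrow> 'a) \<Rightarrow> ('a \<Rightarrow> 'n) set" where
  "onto_homs_std A q e = {f. nBA_hom A q e UNIV std_q std_e f \<and> f ` A = UNIV}"

end

theory Submission
  imports Defs
begin

text \<open>
  Think of an element of \<open>A\<close> as a function into \<open>\<^bold>n\<close> on some space; for a multideal \<open>I\<close>,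
  \<open>I k\<close> then consists of the functions with value \<open>k\<close> on some closed set \<open>C\<close>, and for \<open>a \<in> A\<close> the family \<open>restrict_ideal a r I\<close>
  plays the same role for \<open>C \<inter> {a = r}\<close>. It extends \<open>I\<close>, contains \<open>a\<close> in its \<open>r\<close>-th
  component and satisfies every multideal axiom except possibly disjointness. If disjointness failed
  for all \<open>r\<close>, then the witnesses \<open>d r\<close> could be glued by \<open>q a d\<close> to a witness against the
  disjointness of \<open>I\<close>. So a multideal that is maximal (by Zorn's lemma) is an ultramultideal.
  The ultramultideals are the families of fibres of the homomorphisms onto \<open>\<^bold>n\<close>.
\<close>

section \<open>Working rules for the multideal axioms\<close>

lemma multidealI:
  assumes "\<And>k. I k \<subseteq> A"
    and "\<And>j k a. \<lbrakk>a \<in> I j; a \<in> I k\<rbrakk> \<Longrightarrow> j = k"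
    and "\<And>k. e k \<in> I k"
    and "\<And>r k a b y. \<lbrakk>a \<in> I r; b \<in> I k; \<And>i. y i \<in> A\<rbrakk> \<Longrightarrow> q a (y(r := b)) \<in> I k"
    and "\<And>k a y. \<lbrakk>a \<in> A; \<And>i. y i \<in> I k\<rbrakk> \<Longrightarrow> q a y \<in> I k"
  shows "multideal A q e I"
  unfolding multideal_def
proof (intro conjI)
  show "\<forall>j k. j \<noteq> k \<longrightarrow> I j \<inter> I k = {}" using assms(2) by blast
qed (use assms(1,3-5) in blast)+

lemma multidealD:
  assumes "multideal A q e I"
  shows "a \<in> I k \<Longrightarrow> a \<in> A"
    and "\<lbrakk>a \<in> I j; a \<in> I k\<rbrakk> \<Longrightarrow> j = k"
    and "e k \<in> I k"
    and "\<lbrakk>a \<in> I r; b \<in> I k; \<And>i. y i \<in> A\<rbrakk> \<Longrightarrow> q a (y(r := b)) \<in> I k"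
    and "\<lbrakk>a \<in> A; \<And>i. y i \<in> I k\<rbrakk> \<Longrightarrow> q a y \<in> I k"
  using assms unfolding multideal_def by blast+

text \<open>This is (m2) with the \<open>r\<close>-th argument already in place, since
  \<open>y(r := y r) = y\<close>.\<close>

lemma multideal_select:
  assumes "multideal A q e I" "a \<in> I r" "y r \<in> I k" "\<And>i. y i \<in> A"
  shows "q a y \<in> I k"
  using multidealD(4)[where y = y, OF assms] by simp

section \<open>Maximal multideals via Zorn's lemma\<close>

lemma multideal_Union_chain:
  fixes q :: "'a \<Rightarrow> ('n::finite \<Rightarrow> 'a) \<Rightarrow> 'a" and \<C> :: "('n \<times> 'a) set set"
  assumes chain: "subset.chain {S. multideal A q e (\<lambda>k. S `` {k})} \<C>" and "\<C> \<noteq> {}"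
  shows "multideal A q e (\<lambda>k. \<Union>\<C> `` {k})"
proof -
  \<comment> \<open>Each instance of a multideal axiom assumes only finitely many memberships, so it
    can be checked inside a single member of the chain.\<close>
  have common: "\<exists>S\<in>\<C>. multideal A q e (\<lambda>k. S `` {k}) \<and> F \<subseteq> S"
    if F: "finite F" "F \<subseteq> \<Union>\<C>" for F
  proof -
    obtain S where "S \<in> \<C>" "F \<subseteq> S"
      using finite_subset_Union_chain[OF F \<open>\<C> \<noteq> {}\<close> chain] .
    moreover from this(1) have "multideal A q e (\<lambda>k. S `` {k})"
      using chain by (auto simp: subset.chain_def)
    ultimately show ?thesis by blast
  qed
  show ?thesis
  proof (rule multidealI)
    fix k show "\<Union>\<C> `` {k} \<subseteq> A"
    proof
      fix a assume "a \<in> \<Union>\<C> `` {k}"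
      then obtain S where S: "multideal A q e (\<lambda>k. S `` {k})" "a \<in> S `` {k}"
        using common[of "{(k, a)}"] by auto
      show "a \<in> A" using multidealD(1)[OF S] .
    qed
  next
    fix j k a assume "a \<in> \<Union>\<C> `` {j}" "a \<in> \<Union>\<C> `` {k}"
    then obtain S where S: "multideal A q e (\<lambda>k. S `` {k})" "a \<in> S `` {j}" "a \<in> S `` {k}"
      using common[of "{(j, a), (k, a)}"] by auto
    show "j = k" using multidealD(2)[OF S] .
  next
    fix k
    obtain S where S: "S \<in> \<C>" "multideal A q e (\<lambda>k. S `` {k})"
      using common[of "{}"] by auto
    show "e k \<in> \<Union>\<C> `` {k}" using S(1) multidealD(3)[OF S(2), of k] by blast
  next
    fix r k a b and y :: "'n \<Rightarrow> 'a"
    assume "a \<in> \<Union>\<C> `` {r}" "b \<in> \<Union>\<C> `` {k}" and y: "\<And>i. y i \<in> A"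
    then obtain S where S: "S \<in> \<C>" "multideal A q e (\<lambda>k. S `` {k})" "a \<in> S `` {r}" "b \<in> S `` {k}"
      using common[of "{(r, a), (k, b)}"] by auto
    show "q a (y(r := b)) \<in> \<Union>\<C> `` {k}"
      using S(1) multidealD(4)[where y = y, OF S(2-4) y] by blast
  next
    fix k a and y :: "'n \<Rightarrow> 'a"
    assume a: "a \<in> A" and y: "\<And>i. y i \<in> \<Union>\<C> `` {k}"
    \<comment> \<open>Finiteness of the index type is what puts all arguments of \<open>q\<close>
      into one chain member.\<close>
    have "finite (range (\<lambda>i. (k, y i)))" "range (\<lambda>i. (k, y i)) \<subseteq> \<Union>\<C>"
      using y by auto
    from common[OF this] obtain S
      where S: "S \<in> \<C>" "multideal A q e (\<lambda>k. S `` {k})" "\<And>i. y i \<in> S `` {k}"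
      by auto
    show "q a y \<in> \<Union>\<C> `` {k}"
      using S(1) multidealD(5)[where y = y, OF S(2) a S(3)] by blast
  qed
qed

lemma ex_maximal_multideal:
  fixes q :: "'a \<Rightarrow> ('n::finite \<Rightarrow> 'a) \<Rightarrow> 'a"
  assumes "multideal A q e I"
  obtains M where "multideal A q e M" "I \<le> M" "\<And>J. \<lbrakk>multideal A q e J; M \<le> J\<rbrakk> \<Longrightarrow> J = M"
proof -
  let ?\<A> = "{S. multideal A q e (\<lambda>k. S `` {k}) \<and> Sigma UNIV I \<subseteq> S}"
  have Sigma_Image: "Sigma UNIV J `` {k} = J k" for J :: "'n \<Rightarrow> 'a set" and k
    by auto
  have "\<exists>S\<in>?\<A>. \<forall>X\<in>?\<A>. S \<subseteq> X \<longrightarrow> X = S"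
  proof (rule subset_Zorn_nonempty)
    have "Sigma UNIV I \<in> ?\<A>" using assms by (simp add: Sigma_Image)
    then show "?\<A> \<noteq> {}" by blast
  next
    fix \<C> assume "\<C> \<noteq> {}" and chain: "subset.chain ?\<A> \<C>"
    from chain have "subset.chain {S. multideal A q e (\<lambda>k. S `` {k})} \<C>"
      by (auto simp: subset.chain_def)
    then have "multideal A q e (\<lambda>k. \<Union>\<C> `` {k})"
      using \<open>\<C> \<noteq> {}\<close> by (rule multideal_Union_chain)
    moreover have "\<forall>S\<in>\<C>. Sigma UNIV I \<subseteq> S"
      using chain by (auto simp: subset.chain_def)
    ultimately show "\<Union>\<C> \<in> ?\<A>" using \<open>\<C> \<noteq> {}\<close> by blast
  qed
  then obtain S where "S \<in> ?\<A>" and max: "\<forall>X\<in>?\<A>. S \<subseteq> X \<longrightarrow> X = S"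
    by (rule bexE)
  from this(1) have S: "multideal A q e (\<lambda>k. S `` {k})" "Sigma UNIV I \<subseteq> S"
    by simp_all
  have "J = (\<lambda>k. S `` {k})" if J: "multideal A q e J" "(\<lambda>k. S `` {k}) \<le> J" for J
  proof -
    have "S \<subseteq> Sigma UNIV J" using J(2) by (auto simp: le_fun_def)
    moreover from this S(2) have "Sigma UNIV J \<in> ?\<A>" using J(1) by (simp add: Sigma_Image)
    ultimately have "Sigma UNIV J = S" using max by (simp only: Ball_def)
    then show ?thesis by (auto simp: Sigma_Image)
  qed
  moreover have "I \<le> (\<lambda>k. S `` {k})" using S(2) by (auto simp: le_fun_def)
  ultimately show thesis by (rule that[OF S(1), rotated])
qed

section \<open>Restricting a multideal to the region where \<open>a\<close> takes the value
  \<open>r\<close>\<close>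

context nBA
begin

text \<open>The element tested agrees with \<open>b\<close> where \<open>a\<close> is
  \<open>r\<close> and is \<open>e k\<close> elsewhere. The default \<open>e k\<close> makes the
  condition automatic off that region, so only the values of \<open>b\<close> on it count.\<close>

definition restrict_ideal :: "'a \<Rightarrow> 'n \<Rightarrow> ('n \<Rightarrow> 'a set) \<Rightarrow> 'n \<Rightarrow> 'a set" where
  "restrict_ideal a r I k = {b \<in> A. q a ((\<lambda>_. e k)(r := b)) \<in> I k}"

lemma const_restrict_ideal:
  assumes "multideal A q e I" "a \<in> A"
  shows "e k \<in> restrict_ideal a r I k"
  using assms by (simp add: restrict_ideal_def e_closed B1 multidealD(3) fun_upd_idem)

lemma subset_restrict_ideal:
  assumes "multideal A q e I" "a \<in> A"
  shows "I k \<subseteq> restrict_ideal a r I k"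
proof
  fix b assume b: "b \<in> I k"
  then have "((\<lambda>_. e k)(r := b)) i \<in> I k" for i
    using multidealD(3)[OF assms(1)] by simp
  from multidealD(5)[where y = "(\<lambda>_. e k)(r := b)", OF assms this] multidealD(1)[OF assms(1) b]
  show "b \<in> restrict_ideal a r I k" by (simp add: restrict_ideal_def)
qed

text \<open>Where \<open>a\<close> is \<open>r\<close> it agrees with \<open>e r\<close>. Formally,
  B4 and B1 write \<open>a\<close> as \<open>q a e\<close> and \<open>e r\<close> as
  \<open>q a\<close> of a constant family; the diagonal that B2 then extracts is constantly
  \<open>e r\<close>.\<close>

lemma self_in_restrict_ideal:
  assumes "multideal A q e I" "a \<in> A"
  shows "a \<in> restrict_ideal a r I r"
proof -
  let ?w = "\<lambda>i. if i = r then e else (\<lambda>_. e r)"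
  have w: "(\<lambda>_. e r)(r := a) = (\<lambda>i. q a (?w i))"
    using assms(2) by (auto simp: B4 B1 e_closed)
  have "q a (\<lambda>i. q a (?w i)) = q a (\<lambda>i. ?w i i)"
    by (rule B2) (auto simp: assms(2) e_closed)
  also have "(\<lambda>i. ?w i i) = (\<lambda>_. e r)" by auto
  also have "q a \<dots> = e r" using assms(2) e_closed by (rule B1)
  finally have "q a ((\<lambda>_. e r)(r := a)) \<in> I r"
    using multidealD(3)[OF assms(1)] by (simp only: w)
  then show ?thesis using assms(2) by (simp add: restrict_ideal_def)
qed

text \<open>By B3 with all selectors equal to \<open>a\<close>, applying \<open>q c\<close> commutes
  with the restriction to \<open>a = r\<close>, and (m3) for \<open>I\<close> applies to the
  restricted arguments.\<close>

lemma restrict_ideal_pointwise: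
  assumes "multideal A q e I" "a \<in> A" "c \<in> A" "\<And>i. y i \<in> restrict_ideal a r I k"
  shows "q c y \<in> restrict_ideal a r I k"
proof -
  have y: "y i \<in> A" "q a ((\<lambda>_. e k)(r := y i)) \<in> I k" for i
    using assms(4)[of i] by (auto simp: restrict_ideal_def)
  have "q c (\<lambda>i. q a ((\<lambda>_. e k)(r := y i)))
      = q (q c (\<lambda>_. a)) (\<lambda>j. q c (\<lambda>i. ((\<lambda>_. e k)(r := y i)) j))"
    by (rule B3) (auto simp: assms y e_closed)
  also have "q c (\<lambda>_. a) = a" using assms(3,2) by (rule B1)
  also have "(\<lambda>j. q c (\<lambda>i. ((\<lambda>_. e k)(r := y i)) j)) = (\<lambda>_. e k)(r := q c y)"
    by (auto simp: B1 assms(3) e_closed)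
  finally have "q a ((\<lambda>_. e k)(r := q c y)) \<in> I k"
    using multidealD(5)[where y = "\<lambda>i. q a ((\<lambda>_. e k)(r := y i))", OF assms(1,3) y(2)]
    by (simp only:)
  then show ?thesis by (simp add: restrict_ideal_def q_closed assms(3) y)
qed

lemma restrict_ideal_select:
  assumes "multideal A q e I" "a \<in> A" "c \<in> restrict_ideal a r I s"
    and "y s \<in> restrict_ideal a r I k" and y: "\<And>i. y i \<in> A"
  shows "q c y \<in> restrict_ideal a r I k"
proof -
  have c: "c \<in> A" "q a ((\<lambda>_. e s)(r := c)) \<in> I s"
    and ys: "q a ((\<lambda>_. e k)(r := y s)) \<in> I k"
    using assms(3,4) by (auto simp: restrict_ideal_def)
  \<comment> \<open>B1 rewrites the default \<open>e k\<close> as \<open>q (e s)\<close> of a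
    constant family, so every entry has the form \<open>q (z i) (?w i)\<close>. B3 then gathers the
    selectors into \<open>q a z\<close>, which lies in \<open>I s\<close>, and (m2) for
    \<open>I\<close> picks column \<open>s\<close> of \<open>?w\<close>.\<close>
  let ?w = "\<lambda>i. if i = r then y else (\<lambda>_. e k)"
  have w: "?w i j \<in> A" for i j by (simp add: y e_closed)
  have "q a ((\<lambda>_. e k)(r := q c y)) = q a (\<lambda>i. q (((\<lambda>_. e s)(r := c)) i) (?w i))"
    by (intro arg_cong[of _ _ "q a"]) (auto simp: B1 e_closed)
  also have "\<dots> = q (q a ((\<lambda>_. e s)(r := c))) (\<lambda>j. q a (\<lambda>i. ?w i j))"
    by (rule B3) (auto simp: assms(2) c e_closed y)
  also have "\<dots> \<in> I k"
  proof (rule multideal_select[OF assms(1) c(2)])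
    have "(\<lambda>i. ?w i s) = (\<lambda>_. e k)(r := y s)" by auto
    then show "q a (\<lambda>i. ?w i s) \<in> I k" using ys by simp
  qed (rule q_closed[OF assms(2) w])
  finally show ?thesis by (simp add: restrict_ideal_def q_closed c y)
qed

lemma multideal_restrict_ideal:
  assumes "multideal A q e I" "a \<in> A"
    and "\<And>j k b. \<lbrakk>b \<in> restrict_ideal a r I j; b \<in> restrict_ideal a r I k\<rbrakk> \<Longrightarrow> j = k"
  shows "multideal A q e (restrict_ideal a r I)"
proof (rule multidealI)
  show sub: "restrict_ideal a r I k \<subseteq> A" for k
    by (auto simp: restrict_ideal_def)
  fix s k c b and y :: "'n \<Rightarrow> 'a"
  assume "c \<in> restrict_ideal a r I s" "b \<in> restrict_ideal a r I k" "\<And>i. y i \<in> A"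
  then show "q c (y(s := b)) \<in> restrict_ideal a r I k"
    using sub by (intro restrict_ideal_select[OF assms(1,2)]) auto
qed (fact assms(3) const_restrict_ideal[OF assms(1,2)] restrict_ideal_pointwise[OF assms(1,2)])+

text \<open>The regions \<open>a = r\<close> cover the space, and \<open>q a d\<close> equals
  \<open>d r\<close> on the \<open>r\<close>-th one. B2 replaces each \<open>d r\<close> by its
  restricted version, which lies in \<open>I k\<close>, and (m3) concludes.\<close>

lemma glue_restrict_ideals:
  assumes "multideal A q e I" "a \<in> A" "\<And>r. d r \<in> restrict_ideal a r I k"
  shows "q a d \<in> I k"
proof -
  let ?w = "\<lambda>r. (\<lambda>_. e k)(r := d r)"
  have d: "d r \<in> A" "q a (?w r) \<in> I k" for r
    using assms(3)[of r] by (auto simp: restrict_ideal_def)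
  have "q a (\<lambda>r. q a (?w r)) = q a (\<lambda>r. ?w r r)"
    by (rule B2) (auto simp: assms(2) d e_closed)
  then show ?thesis using multidealD(5)[where y = "\<lambda>r. q a (?w r)", OF assms(1,2) d(2)] by simp
qed

text \<open>An element with two distinct indices \<open>j\<close> and \<open>k\<close> can be
  relabelled: using it to select from \<open>e l\<close> at \<open>j\<close> and \<open>e m\<close>
  elsewhere gives an element with indices \<open>l\<close> and \<open>m\<close>.\<close>

lemma restrict_ideal_overlap:
  assumes "multideal A q e I" "a \<in> A"
    and "b \<in> restrict_ideal a r I j" "b \<in> restrict_ideal a r I k" "j \<noteq> k"
  shows "\<exists>d. d \<in> restrict_ideal a r I l \<and> d \<in> restrict_ideal a r I m"
proof (intro exI conjI)
  let ?y = "(\<lambda>_. e m)(j := e l)"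
  show "q b ?y \<in> restrict_ideal a r I l"
    using assms(3) by (rule restrict_ideal_select[OF assms(1,2)])
      (simp_all add: const_restrict_ideal assms(1,2) e_closed)
  show "q b ?y \<in> restrict_ideal a r I m"
    using assms(4) by (rule restrict_ideal_select[OF assms(1,2)])
      (use assms(5) in \<open>simp_all add: const_restrict_ideal assms(1,2) e_closed\<close>)
qed

lemma ex_multideal_restrict_ideal:
  assumes I: "multideal A q e I" and a: "a \<in> A"
  shows "\<exists>r. multideal A q e (restrict_ideal a r I)"
proof (rule ccontr)
  assume "\<not> ?thesis"
  then have overlap: "\<exists>b j k. b \<in> restrict_ideal a r I j \<and> b \<in> restrict_ideal a r I k \<and> j \<noteq> k" for r
    using multideal_restrict_ideal[OF I a] by blast
  \<comment> \<open>One pair is fixed for all \<open>r\<close>, because gluing requires all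
    witnesses to lie in the same component.\<close>
  obtain l m :: 'n where "l \<noteq> m" using overlap by blast
  have "\<exists>d. d \<in> restrict_ideal a r I l \<and> d \<in> restrict_ideal a r I m" for r
    using overlap[of r] restrict_ideal_overlap[OF I a] by blast
  then obtain d where "\<And>r. d r \<in> restrict_ideal a r I l" "\<And>r. d r \<in> restrict_ideal a r I m"
    by metis
  then have "q a d \<in> I l" "q a d \<in> I m"
    using glue_restrict_ideals[OF I a] by blast+
  with I have "l = m" by (rule multidealD)
  with \<open>l \<noteq> m\<close> show False ..
qed

theorem multideal_extends_to_ultramultideal:
  assumes "multideal A q e I"
  obtains G where "ultramultideal A q e G" "I \<le> G"
proof -
  obtain M where M: "multideal A q e M" "I \<le> M"
    and max: "\<And>J. \<lbrakk>multideal A q e J; M \<le> J\<rbrakk> \<Longrightarrow> J = M"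
    using ex_maximal_multideal[OF assms] by metis
  \<comment> \<open>A restriction of \<open>M\<close> that is a multideal equals \<open>M\<close> by
    maximality, yet its \<open>r\<close>-th component contains \<open>a\<close>.\<close>
  have "a \<in> (\<Union>k. M k)" if a: "a \<in> A" for a
  proof -
    obtain r where "multideal A q e (restrict_ideal a r M)"
      using ex_multideal_restrict_ideal[OF M(1) a] by blast
    moreover have "M \<le> restrict_ideal a r M"
      using subset_restrict_ideal[OF M(1) a] by (simp add: le_fun_def)
    ultimately have "restrict_ideal a r M = M" by (rule max)
    with self_in_restrict_ideal[OF M(1) a, of r] show ?thesis by auto
  qed
  then have "ultramultideal A q e M"
    using M(1) multidealD(1)[OF M(1)] unfolding ultramultideal_def by blast
  from this M(2) show thesis by (rule that)
qed

end

definition component_index :: "'a set \<Rightarrow> ('n \<Rightarrow> 'a set) \<Rightarrow> 'a \<Rightarrow> 'n" where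
  "component_index A G = (\<lambda>a\<in>A. THE k. a \<in> G k)"

lemma component_index_eq:
  assumes "multideal A q e G" "a \<in> G k"
  shows "component_index A G a = k"
  using assms unfolding component_index_def
  by (auto simp: multidealD(1) intro!: the_equality dest: multidealD(2))

lemma fibres_component_index:
  assumes "ultramultideal A q e G"
  shows "{a \<in> A. component_index A G a = k} = G k"
proof -
  have G: "multideal A q e G" "(\<Union>k. G k) = A"
    using assms by (auto simp: ultramultideal_def)
  show ?thesis
    using component_index_eq[OF G(1)] multidealD(1)[OF G(1)] G(2) by blast
qed

lemma component_index_hom:
  assumes "ultramultideal A q e G"
  shows "component_index A G \<in> onto_homs_std A q e"
proof -
  have G: "multideal A q e G" and cover: "(\<Union>k. G k) = A"
    using assms by (auto simp: ultramultideal_def)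
  note eq = component_index_eq[OF G]
  have e: "component_index A G (e k) = k" "e k \<in> A" for k
    using multidealD(3)[OF G] by (auto intro: eq multidealD(1)[OF G])
  have "component_index A G (q y x) = component_index A G (x (component_index A G y))"
    if y: "y \<in> A" and x: "\<And>i. x i \<in> A" for y x
  proof -
    \<comment> \<open>Since \<open>G\<close> covers \<open>A\<close>, both \<open>y\<close> and the
      argument it selects have an index; (m2) is then exactly compatibility with
      \<open>std_q\<close>.\<close>
    obtain r where r: "y \<in> G r" using y cover by blast
    obtain k where k: "x r \<in> G k" using x[of r] cover by blast
    show ?thesis
      using eq[OF r] eq[OF k] eq[OF multideal_select[where y = x, OF G r k x]] by simp
  qed
  moreover have "component_index A G ` A = UNIV"
    using e by (metis UNIV_eq_I imageI)
  moreover have "component_index A G \<in> A \<rightarrow>\<^sub>E UNIV"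
    by (simp add: component_index_def)
  ultimately show ?thesis
    using e by (simp add: onto_homs_std_def nBA_hom_def std_q_def std_e_def)
qed

lemma (in nBA) ultramultideal_fibres:
  assumes "f \<in> onto_homs_std A q e"
  shows "ultramultideal A q e (\<lambda>k. {a \<in> A. f a = k})"
proof -
  have f: "f (e k) = k" "\<lbrakk>y \<in> A; \<And>i. x i \<in> A\<rbrakk> \<Longrightarrow> f (q y x) = f (x (f y))" for k y x
    using assms by (auto simp: onto_homs_std_def nBA_hom_def std_q_def std_e_def)
  have "multideal A q e (\<lambda>k. {a \<in> A. f a = k})"
    by (rule multidealI) (auto simp: f e_closed q_closed)
  then show ?thesis by (auto simp: ultramultideal_def)
qed

lemma component_index_fibres:
  assumes "f \<in> onto_homs_std A q e"
  shows "component_index A (\<lambda>k. {a \<in> A. f a = k}) = f"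
proof -
  \<comment> \<open>Off \<open>A\<close> both sides are \<open>undefined\<close>; this is why
    \<open>component_index\<close> restricts its abstraction to \<open>A\<close>.\<close>
  have "f \<in> extensional A"
    using assms by (auto simp: onto_homs_std_def nBA_hom_def PiE_def)
  then show ?thesis
    by (auto simp: component_index_def fun_eq_iff extensional_def)
qed

theorem (in nBA) bij_betw_component_index:
  "bij_betw (component_index A) {G. ultramultideal A q e G} (onto_homs_std A q e)"
  by (rule bij_betw_byWitness[where f' = "\<lambda>f k. {a \<in> A. f a = k}"])
    (auto simp: fibres_component_index component_index_fibres component_index_hom
      ultramultideal_fibres)

text \<open>The clause on fibres determines \<open>\<Phi>\<close> on ultramultideals, so the second
  part asserts the natural correspondence and not merely equal cardinalities.\<close>

theorem theorem7p12:
  fixes A :: "'a set"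
    and q :: "'a \<Rightarrow> ('n::finite \<Rightarrow> 'a) \<Rightarrow> 'a"
    and e :: "'n \<Rightarrow> 'a"
  assumes "CARD('n) \<ge> 2"
    and "nBA A q e"
  shows "(\<forall>I. multideal A q e I \<longrightarrow>
            (\<exists>G. ultramultideal A q e G \<and> (\<forall>k. I k \<subseteq> G k))) \<and>
         (\<exists>\<Phi>. bij_betw \<Phi> {G. ultramultideal A q e G} (onto_homs_std A q e) \<and>
               (\<forall>G. ultramultideal A q e G \<longrightarrow>
                  (\<forall>k. G k = {a \<in> A. \<Phi> G a = std_e k})))"
proof (intro conjI allI impI)
  interpret nBA A q e by fact
  show "\<exists>G. ultramultideal A q e G \<and> (\<forall>k. I k \<subseteq> G k)" if "multideal A q e I" for I
    using multideal_extends_to_ultramultideal[OF that] by (metis le_funD)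
  show "\<exists>\<Phi>. bij_betw \<Phi> {G. ultramultideal A q e G} (onto_homs_std A q e) \<and>
      (\<forall>G. ultramultideal A q e G \<longrightarrow> (\<forall>k. G k = {a \<in> A. \<Phi> G a = std_e k}))"
    using bij_betw_component_index
    by (intro exI[of _ "component_index A"]) (simp add: std_e_def fibres_component_index)
qed

end
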